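(* Let $A(n)$ denote the number of polyominoes with $n$ cells, where a polyomino is a finite edge-connected set of cells of the square lattice $\mathbb{Z}^2$ and two polyominoes are identified if one is a translate of the other. Let $\lambda = \lim_{n\to\infty} \sqrt[n]{A(n)}$ (Klarner's constant). Then \[ \lambda \le 4.5238. \]
   Context: Cells are unit squares of the square lattice, identified with points of $\mathbb{Z}^2$; two cells are edge-adjacent if their coordinates differ by $1$ in exactly one coordinate. The limit defining $\lambda$ exists. *)

theory Defs
  imports Complex_Main
begin

type_synonym cell = "int \<times> int"

definition edge_adjacent :: "cell \<Rightarrow> cell \<Rightarrow> bool" where
  "edge_adjacent c d \<longleftrightarrow>
     (\<bar>fst c - fst d\<bar> = 1 \<and> snd c = snd d) \<or> (fst c = fst d \<and> \<bar>snd c - snd d\<bar> = 1)"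

definition edge_connected :: "cell set \<Rightarrow> bool" where
  "edge_connected P \<longleftrightarrow>
     (\<forall>c\<in>P. \<forall>d\<in>P. (c, d) \<in> {(u, v). u \<in> P \<and> v \<in> P \<and> edge_adjacent u v}\<^sup>*)"

definition polyomino :: "cell set \<Rightarrow> bool" where
  "polyomino P \<longleftrightarrow> finite P \<and> P \<noteq> {} \<and> edge_connected P"

definition translate :: "cell \<Rightarrow> cell set \<Rightarrow> cell set" where
  "translate t P = (\<lambda>c. (fst c + fst t, snd c + snd t)) ` P"

definition polyominoes :: "nat \<Rightarrow> cell set set" where
  "polyominoes n = {P. polyomino P \<and> card P = n}"

definition translation_rel :: "nat \<Rightarrow> (cell set \<times> cell set) set" where
  "translation_rel n =
     {(P, Q). P \<in> polyominoes n \<and> Q \<in> polyominoes n \<and> (\<exists>t. Q = translate t P)}"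

lemma equiv_translation_rel: "equiv (polyominoes n) (translation_rel n)"
proof (rule equivI)
  show "translation_rel n \<subseteq> polyominoes n \<times> polyominoes n"
    by (auto simp: translation_rel_def)
  have "P = translate (0, 0) P" for P
    by (auto simp: translate_def)
  then show "refl_on (polyominoes n) (translation_rel n)"
    unfolding refl_on_def translation_rel_def by blast
  have "P = translate (- fst t, - snd t) (translate t P)" for t P
    by (simp add: translate_def image_image)
  then show "sym (translation_rel n)"
    unfolding sym_def translation_rel_def by blast
  have "translate s (translate t P) = translate (fst t + fst s, snd t + snd s) P" for s t P
    by (simp add: translate_def image_image add.assoc)
  then show "trans (translation_rel n)"
    unfolding trans_def translation_rel_def by blast
qed

definition num_polyominoes :: "nat \<Rightarrow> nat" where
  "num_polyominoes n = card (polyominoes n // translation_rel n)"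

definition klarner_constant :: real where
  "klarner_constant = lim (\<lambda>n. root n (real (num_polyominoes n)))"

end

theory Submission
  imports Defs "HOL-Library.Product_Lexorder"
begin

text \<open>
  For cell sets \<open>X\<close> (blocked) and \<open>R\<close> (seeds) let \<open>W(X, R)\<close> be the sum of \<open>z\<close> to the power \<open>|S|\<close> over
  the finite sets \<open>S\<close> of cells that avoid \<open>X\<close> and each of whose components meets \<open>R\<close>. Three facts
  bound it. Revealing whether a seed \<open>r\<close> lies in \<open>S\<close> gives
  \<open>W(X, R) = W(X + r, R - r) + z W(X + r, (R - r) \<union> N(r))\<close>, where \<open>N(r)\<close> are the neighbours of \<open>r\<close>.
  Separating the components that meet \<open>R1\<close> from the others, which therefore avoid \<open>R1\<close>, gives
  \<open>W(X, R1 \<union> R2) \<le> W(X, R1) W(X \<union> R1, R2)\<close>. Finally, \<open>W\<close> grows when cells of \<open>X\<close> are forgotten,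
  and it is invariant under isometries of the lattice.

  With these rules 36 local configurations \<open>(X, R)\<close> close up into a system of polynomial inequalities
  which has a solution at \<open>z = 1 / 4.5238\<close>; by induction on the size of \<open>S\<close> any such solution bounds
  \<open>W\<close> on these configurations. As \<open>W({}, {(0, 0)})\<close> dominates \<open>A(n) z^n\<close>, this bounds \<open>A(n)\<close>.
  That the limit exists follows from Fekete's lemma: placing the lexicographically least cell of one
  polyomino right after the greatest cell of another shows that \<open>A\<close> is supermultiplicative.
\<close>

section \<open>Sets of cells grown from seeds\<close>

definition adj_in :: "cell set \<Rightarrow> (cell \<times> cell) set" where
  "adj_in S = {(u, v). u \<in> S \<and> v \<in> S \<and> edge_adjacent u v}"

lemma adj_in_mono: "S \<subseteq> T \<Longrightarrow> (adj_in S)\<^sup>* \<subseteq> (adj_in T)\<^sup>*"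
  by (rule rtrancl_mono) (auto simp: adj_in_def)

text \<open>The cutoff \<open>n\<close> makes the family finite for finite \<open>R\<close>, so its
  generating function is a finite sum and convergence is no issue; it also serves as induction
  parameter. Seeds are optional: \<open>S\<close> may miss any of them, and the empty set always
  belongs.\<close>

definition animals :: "nat \<Rightarrow> cell set \<Rightarrow> cell set \<Rightarrow> cell set set" where
  "animals n X R = {S. finite S \<and> card S \<le> n \<and> S \<inter> X = {} \<and>
     (\<forall>c\<in>S. \<exists>r\<in>R \<inter> S. (r, c) \<in> (adj_in S)\<^sup>*)}"

text \<open>A seed in \<open>X\<close> can never lie in \<open>S\<close>, so blocked seeds may be
  dropped.\<close>

lemma animals_mono:
  assumes "X' \<subseteq> X" "R \<subseteq> R' \<union> X"
  shows "animals n X R \<subseteq> animals n X' R'"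
  using assms unfolding animals_def by fastforce

lemma animals_0: "animals 0 X R = {{}}"
  by (auto simp: animals_def)

lemma animals_blocked: "R \<subseteq> X \<Longrightarrow> animals n X R = {{}}"
  by (fastforce simp: animals_def)

text \<open>If \<open>r\<close> lies in \<open>S\<close>, delete it: after its last visit to
  \<open>r\<close>, a path in \<open>S\<close> continues at a neighbour of \<open>r\<close>, so the
  neighbours become seeds. Only this branch lowers the cutoff.\<close>

lemma animals_reveal:
  "animals (Suc n) X R \<subseteq> animals (Suc n) (insert r X) (R - {r}) \<union>
     insert r ` animals n (insert r X) (R - {r} \<union> {c. edge_adjacent r c})"
proof
  fix S assume S: "S \<in> animals (Suc n) X R"
  show "S \<in> animals (Suc n) (insert r X) (R - {r}) \<union>
     insert r ` animals n (insert r X) (R - {r} \<union> {c. edge_adjacent r c})"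
  proof (cases "r \<in> S")
    case False
    with S show ?thesis by (fastforce simp: animals_def)
  next
    case True
    define T where "T = S - {r}"
    let ?Q = "R - {r} \<union> {c. edge_adjacent r c}"
    have fin: "finite S" "card S \<le> Suc n" and XS: "S \<inter> X = {}"
      using S by (auto simp: animals_def)
    have step: "c = r \<or> (\<exists>q\<in>?Q \<inter> T. (q, c) \<in> (adj_in T)\<^sup>*)"
      if "(s, c) \<in> (adj_in S)\<^sup>*" "s \<in> R \<inter> S" for s c
      using that(1)
    proof (induction rule: rtrancl_induct)
      case base
      then show ?case using that(2) by (auto simp: T_def)
    next
      case (step c d)
      have cd: "c \<in> S" "d \<in> S" "edge_adjacent c d"
        using step.hyps(2) by (auto simp: adj_in_def)
      consider "d = r" | "d \<noteq> r" "c = r" | "d \<noteq> r" "c \<noteq> r" by blast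
      then show ?case
      proof cases
        case 2
        then have "d \<in> ?Q \<inter> T" using cd by (auto simp: T_def)
        then show ?thesis by blast
      next
        case 3
        then obtain q where "q \<in> ?Q \<inter> T" "(q, c) \<in> (adj_in T)\<^sup>*"
          using step.IH by blast
        moreover have "(c, d) \<in> adj_in T"
          using cd 3 by (auto simp: adj_in_def T_def)
        ultimately show ?thesis by (meson rtrancl.rtrancl_into_rtrancl)
      qed simp
    qed
    have "T \<in> animals n (insert r X) ?Q"
      unfolding animals_def
    proof (intro CollectI conjI ballI)
      show "finite T" "card T \<le> n" "T \<inter> insert r X = {}"
        using fin XS True by (auto simp: T_def)
      fix c assume c: "c \<in> T"
      then obtain s where "s \<in> R \<inter> S" "(s, c) \<in> (adj_in S)\<^sup>*"
        using S by (auto simp: animals_def T_def)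
      then show "\<exists>q\<in>?Q \<inter> T. (q, c) \<in> (adj_in T)\<^sup>*"
        using step[of s c] c unfolding T_def by blast
    qed
    moreover have "S = insert r T" using True by (auto simp: T_def)
    ultimately show ?thesis by blast
  qed
qed

lemma animals_split:
  assumes "S \<in> animals n X (R1 \<union> R2)"
  obtains S1 S2 where "S = S1 \<union> S2" "S1 \<inter> S2 = {}"
    "S1 \<in> animals n X R1" "S2 \<in> animals n (X \<union> R1) R2"
proof -
  have fin: "finite S" "card S \<le> n" and XS: "S \<inter> X = {}"
    using assms by (auto simp: animals_def)
  define S1 where "S1 = {c \<in> S. \<exists>r\<in>R1 \<inter> S. (r, c) \<in> (adj_in S)\<^sup>*}"
  define S2 where "S2 = S - S1"
  have sub: "S1 \<subseteq> S" "S2 \<subseteq> S" by (auto simp: S1_def S2_def)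
  \<comment> \<open>\<open>S1\<close> is a union of components of \<open>S\<close>, so no path
    crosses between \<open>S1\<close> and \<open>S2\<close>.\<close>
  have closed: "d \<in> S1" if "c \<in> S1" "(c, d) \<in> adj_in S" for c d
    using that unfolding S1_def by (auto simp: adj_in_def intro: rtrancl_into_rtrancl)
  have path1: "c \<in> S1 \<and> (r, c) \<in> (adj_in S1)\<^sup>*" if "(r, c) \<in> (adj_in S)\<^sup>*" "r \<in> R1 \<inter> S" for r c
    using that(1)
  proof (induction rule: rtrancl_induct)
    case base
    then show ?case using that(2) by (auto simp: S1_def)
  next
    case (step c d)
    then have "d \<in> S1" using closed by blast
    with step have "(c, d) \<in> adj_in S1" by (auto simp: adj_in_def)
    with step \<open>d \<in> S1\<close> show ?case by (meson rtrancl.rtrancl_into_rtrancl)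
  qed
  \<comment> \<open>Membership is assumed of the last cell, because the seed at the start is not yet
    known to lie in \<open>S2\<close>; once it does, it is outside \<open>R1\<close> and hence in
    \<open>R2\<close>.\<close>
  have path2: "c \<in> S2 \<longrightarrow> r \<in> S2 \<and> (r, c) \<in> (adj_in S2)\<^sup>*" if "(r, c) \<in> (adj_in S)\<^sup>*" for r c
    using that
  proof (induction rule: rtrancl_induct)
    case (step c d)
    show ?case
    proof
      assume d: "d \<in> S2"
      have "c \<in> S2" using step.hyps(2) d closed[of c d] by (auto simp: S2_def adj_in_def)
      moreover from this d step.hyps(2) have "(c, d) \<in> adj_in S2" by (auto simp: adj_in_def)
      ultimately show "r \<in> S2 \<and> (r, d) \<in> (adj_in S2)\<^sup>*"
        using step.IH by (meson rtrancl.rtrancl_into_rtrancl)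
    qed
  qed simp
  have R1S2: "R1 \<inter> S2 = {}" by (auto simp: S1_def S2_def)
  have "S1 \<in> animals n X R1"
    unfolding animals_def
  proof (intro CollectI conjI ballI)
    show "finite S1" "card S1 \<le> n" "S1 \<inter> X = {}"
      using fin XS sub by (auto intro: finite_subset order_trans[OF card_mono])
    fix c assume "c \<in> S1"
    then obtain r where "r \<in> R1 \<inter> S" "(r, c) \<in> (adj_in S)\<^sup>*" by (auto simp: S1_def)
    then show "\<exists>r\<in>R1 \<inter> S1. (r, c) \<in> (adj_in S1)\<^sup>*"
      using path1 by blast
  qed
  moreover have "S2 \<in> animals n (X \<union> R1) R2"
    unfolding animals_def
  proof (intro CollectI conjI ballI)
    show "finite S2" "card S2 \<le> n" "S2 \<inter> (X \<union> R1) = {}"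
      using fin XS sub R1S2 by (auto intro: finite_subset order_trans[OF card_mono])
    fix c assume c: "c \<in> S2"
    then obtain r where "r \<in> (R1 \<union> R2) \<inter> S" "(r, c) \<in> (adj_in S)\<^sup>*"
      using assms sub unfolding animals_def by blast
    then show "\<exists>r\<in>R2 \<inter> S2. (r, c) \<in> (adj_in S2)\<^sup>*"
      using path2 c R1S2 by blast
  qed
  moreover have "S = S1 \<union> S2" "S1 \<inter> S2 = {}" using sub by (auto simp: S2_def)
  ultimately show ?thesis using that by blast
qed

lemma edge_adjacent_finite: "finite {c. edge_adjacent r c}"
proof -
  obtain x y where r: "r = (x, y)" by (cases r)
  have "{c. edge_adjacent r c} \<subseteq> {(x + 1, y), (x - 1, y), (x, y + 1), (x, y - 1)}"
    by (auto simp: r edge_adjacent_def)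
  then show ?thesis by (rule finite_subset) simp
qed

text \<open>Nested induction on \<open>n\<close> and \<open>R\<close>: revealing a seed either
  removes it from \<open>R\<close> or lowers \<open>n\<close> while adding finitely many
  seeds.\<close>

lemma finite_animals: "finite R \<Longrightarrow> finite (animals n X R)"
proof (induction n arbitrary: X R)
  case 0
  then show ?case by (simp add: animals_0)
next
  case (Suc n)
  show ?case using Suc.prems
  proof (induction R arbitrary: X rule: finite_induct)
    case empty
    then show ?case by (simp add: animals_blocked)
  next
    case (insert r R)
    have "finite (animals (Suc n) (insert r X) (insert r R - {r}))"
      using insert by simp
    moreover have "finite (animals n (insert r X) (insert r R - {r} \<union> {c. edge_adjacent r c}))"
      using insert by (intro Suc.IH) (simp add: edge_adjacent_finite)
    ultimately show ?case
      using animals_reveal by (meson finite_UnI finite_imageI finite_subset)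
  qed
qed

section \<open>Truncated generating functions and their inequalities\<close>

definition weight :: "real \<Rightarrow> nat \<Rightarrow> cell set \<Rightarrow> cell set \<Rightarrow> real" where
  "weight z n X R = (\<Sum>S\<in>animals n X R. z ^ card S)"

context
  fixes z :: real
  assumes z: "0 \<le> z"
begin

lemma weight_nonneg: "0 \<le> weight z n X R"
  unfolding weight_def by (intro sum_nonneg) (simp add: z)

lemma weight_mono:
  assumes "X' \<subseteq> X" "R \<subseteq> R' \<union> X" "finite R'"
  shows "weight z n X R \<le> weight z n X' R'"
  unfolding weight_def
  by (rule sum_mono2) (use assms finite_animals animals_mono z in auto)

lemma weight_reveal:
  assumes "finite R"
  shows "weight z (Suc n) X R \<le> weight z (Suc n) (insert r X) (R - {r}) +
     z * weight z n (insert r X) (R - {r} \<union> {c. edge_adjacent r c})"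
proof -
  let ?A = "animals (Suc n) (insert r X) (R - {r})"
  let ?B = "animals n (insert r X) (R - {r} \<union> {c. edge_adjacent r c})"
  have fin: "finite ?A" "finite ?B"
    using assms by (auto intro!: finite_animals simp: edge_adjacent_finite)
  \<comment> \<open>Members of \<open>?B\<close> avoid \<open>r\<close>, so inserting it is
    injective and adds exactly one cell.\<close>
  have inj: "inj_on (insert r) ?B"
    by (rule inj_onI) (auto simp: animals_def insert_eq_iff)
  have "weight z (Suc n) X R \<le> (\<Sum>S\<in>?A \<union> insert r ` ?B. z ^ card S)"
    unfolding weight_def by (rule sum_mono2) (use fin animals_reveal z in auto)
  also have "\<dots> \<le> (\<Sum>S\<in>?A. z ^ card S) + (\<Sum>S\<in>insert r ` ?B. z ^ card S)"
    using fin sum.union_inter[of ?A "insert r ` ?B" "\<lambda>S. z ^ card S"]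
      sum_nonneg[of "?A \<inter> insert r ` ?B" "\<lambda>S. z ^ card S"] z by simp
  also have "(\<Sum>S\<in>insert r ` ?B. z ^ card S) = (\<Sum>S\<in>?B. z ^ card (insert r S))"
    using inj by (simp add: sum.reindex)
  also have "\<dots> = (\<Sum>S\<in>?B. z * z ^ card S)"
    by (rule sum.cong) (auto simp: animals_def)
  finally show ?thesis by (simp add: weight_def sum_distrib_left)
qed

lemma weight_split:
  assumes "finite R1" "finite R2"
  shows "weight z n X (R1 \<union> R2) \<le> weight z n X R1 * weight z n (X \<union> R1) R2"
proof -
  let ?A = "animals n X R1" and ?B = "animals n (X \<union> R1) R2"
  \<comment> \<open>Disjointness makes the cardinalities add; once the weight has factored, it is
    forgotten, which only enlarges the sum.\<close>
  let ?P = "{p \<in> ?A \<times> ?B. fst p \<inter> snd p = {}}"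
  have fin: "finite (?A \<times> ?B)" using assms by (simp add: finite_animals)
  then have finP: "finite ?P" by simp
  have "animals n X (R1 \<union> R2) \<subseteq> (\<lambda>p. fst p \<union> snd p) ` ?P"
  proof
    fix S assume "S \<in> animals n X (R1 \<union> R2)"
    then obtain S1 S2 where "S = S1 \<union> S2" "S1 \<inter> S2 = {}" "S1 \<in> ?A" "S2 \<in> ?B"
      by (rule animals_split)
    then show "S \<in> (\<lambda>p. fst p \<union> snd p) ` ?P" by (intro image_eqI[of _ _ "(S1, S2)"]) auto
  qed
  then have "weight z n X (R1 \<union> R2) \<le> (\<Sum>S\<in>(\<lambda>p. fst p \<union> snd p) ` ?P. z ^ card S)"
    unfolding weight_def by (intro sum_mono2) (use finP z in auto)
  also have "\<dots> \<le> (\<Sum>p\<in>?P. z ^ card (fst p \<union> snd p))"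
    by (rule order_trans[OF sum_image_le]) (use finP z in auto)
  also have "\<dots> = (\<Sum>p\<in>?P. z ^ card (fst p) * z ^ card (snd p))"
    by (rule sum.cong) (auto simp: animals_def card_Un_disjoint power_add)
  also have "\<dots> \<le> (\<Sum>p\<in>?A \<times> ?B. z ^ card (fst p) * z ^ card (snd p))"
    by (rule sum_mono2) (use fin z in auto)
  also have "\<dots> = weight z n X R1 * weight z n (X \<union> R1) R2"
    unfolding weight_def by (simp add: sum_product sum.cartesian_product case_prod_beta)
  finally show ?thesis .
qed

lemma weight_isometry:
  assumes "bij f" "\<And>u v. edge_adjacent (f u) (f v) = edge_adjacent u v" "finite R"
  shows "weight z n (f ` X) (f ` R) \<le> weight z n X R"
proof -
  have inj: "inj f" using assms(1) by (simp add: bij_is_inj)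
  have "animals n (f ` X) (f ` R) \<subseteq> (`) f ` animals n X R"
  proof
    fix S assume S: "S \<in> animals n (f ` X) (f ` R)"
    define T where "T = f -` S"
    have ST: "S = f ` T" using assms(1) by (simp add: T_def surj_image_vimage_eq bij_is_surj)
    have path: "(u, v) \<in> (adj_in T)\<^sup>*" if "(u', v') \<in> (adj_in S)\<^sup>*" "u' = f u" "v' = f v" for u v u' v'
      using that
    proof (induction arbitrary: v rule: rtrancl_induct)
      case base
      then show ?case using inj by (simp add: inj_eq)
    next
      case (step y w)
      then obtain x where x: "y = f x" using assms(1) by (metis bij_pointE)
      then have "(x, v) \<in> adj_in T"
        using step.hyps(2) step.prems assms(2) by (auto simp: adj_in_def T_def)
      then show ?case using step.IH[of x] step.prems(1) x by (auto intro: rtrancl_into_rtrancl)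
    qed
    have "T \<in> animals n X R"
      unfolding animals_def
    proof (intro CollectI conjI ballI)
      show "finite T" "card T \<le> n" "T \<inter> X = {}"
        using S inj finite_imageD[of f T] inj_on_subset[OF inj, of T] card_image[of f T]
        by (auto simp: animals_def ST)
      fix c assume "c \<in> T"
      then obtain r where "r \<in> R" "f r \<in> S" "(f r, f c) \<in> (adj_in S)\<^sup>*"
        using S by (auto simp: animals_def T_def)
      then show "\<exists>r\<in>R \<inter> T. (r, c) \<in> (adj_in T)\<^sup>*"
        using path[OF _ refl refl] unfolding T_def by blast
    qed
    then show "S \<in> (`) f ` animals n X R" using ST by blast
  qed
  then have "weight z n (f ` X) (f ` R) \<le> (\<Sum>S\<in>(`) f ` animals n X R. z ^ card S)"
    unfolding weight_def by (intro sum_mono2) (use z assms finite_animals in auto)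
  also have "\<dots> \<le> (\<Sum>S\<in>animals n X R. z ^ card (f ` S))"
    by (rule order_trans[OF sum_image_le]) (use assms finite_animals z in auto)
  also have "\<dots> = weight z n X R"
    unfolding weight_def using inj_on_subset[OF inj] by (intro sum.cong) (auto simp: card_image)
  finally show ?thesis .
qed

end

section \<open>A certificate for the growth rate\<close>

text \<open>For \<open>a\<close> and \<open>b\<close> equal to 1 or -1 these are exactly the
  isometries of the lattice: \<open>w\<close> swaps the axes, \<open>a\<close> and \<open>b\<close>
  reflect, \<open>(s, t)\<close> translates.\<close>

fun place :: "bool \<times> int \<times> int \<times> int \<times> int \<Rightarrow> cell \<Rightarrow> cell" where
  "place (w, a, b, s, t) (x, y) = (if w then (a * y + s, b * x + t) else (a * x + s, b * y + t))"

lemma place_isometry: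
  assumes "a = 1 \<or> a = - 1" "b = 1 \<or> b = - 1"
  shows "bij (place (w, a, b, s, t))"
    and "edge_adjacent (place (w, a, b, s, t) u) (place (w, a, b, s, t) v) = edge_adjacent u v"
proof -
  let ?g = "\<lambda>(x, y). if w then (b * (y - t), a * (x - s)) else (a * (x - s), b * (y - t))"
  have "?g (place (w, a, b, s, t) u) = u" "place (w, a, b, s, t) (?g u) = u" for u
    using assms by (cases u; auto)+
  then show "bij (place (w, a, b, s, t))"
    by (intro o_bij[of ?g]) (auto simp: fun_eq_iff)
  show "edge_adjacent (place (w, a, b, s, t) u) (place (w, a, b, s, t) v) = edge_adjacent u v"
    using assms by (cases u; cases v) (auto simp: edge_adjacent_def)
qed

text \<open>
  A piece \<open>(i, g)\<close> stands for the image of the \<open>i\<close>-th configuration under the isometry \<open>place g\<close>.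
  A state \<open>(r # R, X, p, E, P)\<close> claims that \<open>W(X, r # R)\<close> is at most \<open>p / scale\<close>; the seed to be
  revealed is \<open>r\<close>, and \<open>E\<close> and \<open>P\<close> are the pieces into which the configuration is split when \<open>r\<close> is
  absent and present, respectively.
\<close>

type_synonym piece = "nat \<times> bool \<times> int \<times> int \<times> int \<times> int"
type_synonym state = "cell list \<times> cell list \<times> int \<times> piece list \<times> piece list"

definition seeds :: "state \<Rightarrow> cell list" where "seeds = fst"
definition blocked :: "state \<Rightarrow> cell list" where "blocked = fst \<circ> snd"
definition bound :: "state \<Rightarrow> int" where "bound = fst \<circ> snd \<circ> snd"

fun nbrs :: "cell \<Rightarrow> cell list" where
  "nbrs (x, y) = [(x + 1, y), (x - 1, y), (x, y + 1), (x, y - 1)]"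

lemma edge_adjacent_nbrs: "{c. edge_adjacent r c} = set (nbrs r)"
  by (cases r) (auto simp: edge_adjacent_def)

text \<open>Pieces are split off from left to right, so their order matters: the seeds of one piece
  count as blocked for the next ones. What a piece needs blocked must be blocked by then, and at the
  end every seed of \<open>R\<close> must have been used up. A piece may bring seeds outside
  \<open>R\<close>, since extra seeds only increase the weight.\<close>

fun covers :: "state list \<Rightarrow> cell list \<Rightarrow> cell list \<Rightarrow> piece list \<Rightarrow> bool" where
  "covers cs X R [] = list_all (List.member X) R"
| "covers cs X R ((i, w, a, b, s, t) # ps) \<longleftrightarrow>
     i < length cs \<and> (a = 1 \<or> a = - 1) \<and> (b = 1 \<or> b = - 1) \<and>
     list_all (\<lambda>c. List.member X (place (w, a, b, s, t) c)) (blocked (cs ! i)) \<and>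
     covers cs (map (place (w, a, b, s, t)) (seeds (cs ! i)) @ X) R ps"

definition bounds :: "state list \<Rightarrow> piece list \<Rightarrow> int" where
  "bounds cs ps = prod_list (map (\<lambda>p. bound (cs ! fst p)) ps)"

text \<open>Bounds are integer multiples of \<open>1 / scale\<close>, so that checking the
  certificate is pure integer arithmetic.\<close>

definition scale :: int where "scale = 100000"

text \<open>
  The requirement on the number of seeds in \<open>E\<close> makes the induction well-founded, since the bound on
  \<open>|S|\<close> does not decrease when \<open>r\<close> is absent. The last inequality is
  \<open>(product of the bounds over E) + z (product of the bounds over P) \<le> p / scale\<close> for
  \<open>z = 10000 / 45238\<close>, with denominators cleared.
\<close>

fun valid_state :: "state list \<Rightarrow> state \<Rightarrow> bool" where
  "valid_state cs ([], X, p, E, P) = False"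
| "valid_state cs (r # R, X, p, E, P) \<longleftrightarrow>
     scale \<le> p \<and>
     list_all (\<lambda>q. length (seeds (cs ! fst q)) \<le> length R) E \<and>
     covers cs (r # X) R E \<and>
     covers cs (r # X) (nbrs r @ R) P \<and>
     45238 * scale ^ Suc (length P) * bounds cs E + 10000 * scale ^ Suc (length E) * bounds cs P
       \<le> 45238 * scale ^ (length E + length P) * p"

text \<open>
  The configurations were found by a greedy computer search, and the bounds by iterating the
  inequalities to a fixed point with a relative slack of \<open>10^-5\<close>.
\<close>

definition certificate :: "state list" where
  "certificate = [
   ([(0, 0)],
    [],
    3066490, [],
    [(1, False, -1, 1, 0, -1), (2, False, 1, 1, 1, 0)]),
   ([(1, 1), (0, 0), (0, 2)],
    [(0, 1)],
    3942815, [(3, False, -1, 1, 0, 0)],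
    [(3, False, -1, 1, 0, 0), (4, False, 1, 1, 1, 0)]),
   ([(0, 0)],
    [(-1, -1), (-1, 0)],
    340358, [],
    [(4, False, 1, 1, 0, -1)]),
   ([(0, 0), (0, 2)],
    [(-1, 1), (0, 1)],
    1158433, [(2, True, 1, 1, 0, 2)],
    [(4, True, 1, -1, -1, 0), (2, True, 1, 1, 0, 2)]),
   ([(0, 2), (0, 0), (1, 1)],
    [(-1, 0), (-1, 1), (0, 1)],
    1087314, [(5, False, 1, 1, 0, 0)],
    [(5, False, 1, 1, 0, 0), (6, True, 1, 1, -1, 2)]),
   ([(0, 0), (1, 1)],
    [(-1, 0), (0, 1), (0, 2)],
    423382, [(7, False, 1, 1, 1, 1)],
    [(8, False, -1, -1, 1, 1)]),
   ([(1, 1), (0, 0), (0, 2)],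
    [(-2, 0), (-1, 0), (-1, 1), (-1, 2), (0, 1)],
    709395, [(9, True, 1, 1, 0, 2), (10, False, 1, -1, 0, 0)],
    [(11, True, 1, 1, 0, 0)]),
   ([(0, 0)],
    [(-2, -1), (-1, -1), (-1, 0), (-1, 1)],
    256817, [],
    [(6, False, 1, 1, 0, -1)]),
   ([(0, 0), (0, 1), (1, 2)],
    [(1, -1), (1, 0), (1, 1), (2, 1)],
    753488, [(5, True, 1, 1, 0, 1)],
    [(12, False, -1, -1, 1, 2)]),
   ([(0, 0)],
    [(-1, 0), (-1, 1), (0, -1)],
    193592, [],
    [(5, False, 1, -1, 0, 1)]),
   ([(0, 0)],
    [(-2, 0), (-1, -1), (-1, 0), (0, -1), (1, -1)],
    191818, [],
    [(13, False, 1, -1, 0, 1)]),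
   ([(0, 1), (0, 0), (1, 2), (2, 0), (2, 1)],
    [(0, -2), (0, -1), (1, -1), (1, 0), (1, 1), (2, -1)],
    1529242, [(14, False, -1, 1, 2, 0)],
    [(15, False, -1, 1, 2, 0)]),
   ([(1, 1), (0, 0), (1, 3), (2, 2)],
    [(-1, 1), (0, 1), (0, 2), (0, 3), (1, 2)],
    1493303, [(16, False, 1, 1, 0, 0)],
    [(17, True, 1, 1, 0, 0)]),
   ([(1, 1), (0, 0)],
    [(-2, 1), (-1, 1), (-1, 2), (0, 1), (1, 2)],
    415358, [(18, True, 1, -1, 0, 0)],
    [(8, True, 1, 1, 0, 0)]),
   ([(2, 0), (0, 0), (0, 1), (1, 2)],
    [(0, -1), (1, -1), (1, 0), (1, 1), (2, -2), (2, -1), (2, 1)],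
    960282, [(19, False, 1, 1, 0, 0)],
    [(18, False, 1, 1, 3, 0), (19, False, 1, 1, 0, 0)]),
   ([(2, 0), (0, 0), (0, 1), (1, 2), (2, 2), (3, 1)],
    [(0, -1), (1, -1), (1, 0), (1, 1), (2, -1), (2, 1)],
    2573794, [(20, False, 1, 1, 0, 0)],
    [(21, False, 1, 1, 0, 0)]),
   ([(0, 0), (1, 3), (2, 2)],
    [(-1, 1), (0, 1), (0, 3), (1, 1), (1, 2)],
    1074733, [(5, False, 1, -1, 1, 3)],
    [(6, True, -1, -1, 1, 0), (13, True, -1, 1, 2, 2)]),
   ([(1, 2), (0, 0), (0, 1), (2, 2), (3, 1)],
    [(1, -1), (1, 0), (1, 1), (2, 0), (2, 1), (3, 0)],
    1893460, [(22, False, 1, -1, 2, 2), (23, False, -1, 1, 0, 0)],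
    [(24, False, 1, 1, 0, 0)]),
   ([(0, 0)],
    [(-2, -1), (-1, -2), (-1, -1), (-1, 0), (-1, 1)],
    248793, [],
    [(25, False, 1, 1, 0, -1)]),
   ([(0, 0), (0, 1), (1, 2)],
    [(0, -1), (1, 0), (1, 1), (2, 1)],
    619544, [(5, True, 1, 1, 0, 1)],
    [(26, False, -1, -1, 1, 2)]),
   ([(0, 1), (0, 0), (1, 2), (2, 2), (3, 1)],
    [(0, -1), (1, -1), (1, 0), (1, 1), (2, 0), (2, 1)],
    1930220, [(8, True, 1, -1, 1, 2), (27, False, -1, 1, 0, 0)],
    [(28, True, 1, -1, -1, 2)]),
   ([(0, 0), (0, 1), (1, 2), (2, 2), (3, 0), (3, 1)],
    [(0, -1), (1, 0), (1, 1), (2, -1), (2, 0), (2, 1)],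
    2911286, [(17, False, -1, 1, 3, 0)],
    [(5, False, -1, -1, 0, 1), (29, False, -1, 1, 3, 0)]),
   ([(0, 0), (1, 1)],
    [(-1, 0), (0, 1), (1, 2)],
    330547, [(9, False, 1, -1, 1, 1)],
    [(19, False, -1, -1, 1, 1)]),
   ([(0, 1), (0, 0)],
    [(-2, 0), (-1, -1), (-1, 0), (-1, 1), (-1, 2)],
    342386, [(9, False, 1, -1, 0, 0)],
    [(25, False, 1, 1, 0, 0)]),
   ([(2, 2), (0, 0), (0, 1), (0, 2), (1, 3), (3, 1)],
    [(1, -1), (1, 0), (1, 1), (1, 2), (2, 1), (3, 0)],
    3445749, [(9, False, 1, 1, 3, 1), (30, False, 1, 1, 0, 0)],
    [(21, False, -1, 1, 3, 1), (10, True, -1, -1, 0, 0)]),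
   ([(1, 1), (0, 0), (0, 2)],
    [(-2, 0), (-1, -1), (-1, 0), (-1, 1), (-1, 2), (0, 1)],
    673100, [(31, False, 1, 1, 0, 0)],
    [(11, True, 1, 1, 0, 0)]),
   ([(1, 1), (0, 0), (2, 2)],
    [(-1, 1), (0, 1), (0, 2), (1, 2), (1, 3)],
    887372, [(32, False, 1, 1, 0, 0)],
    [(29, False, -1, -1, 2, 2)]),
   ([(0, 0)],
    [(-1, -1), (-1, 0), (0, -1), (0, 1)],
    156772, [],
    [(7, False, 1, 1, 1, 0)]),
   ([(0, 1), (0, 2), (0, 3), (1, 0), (1, 4), (2, 1)],
    [(1, 1), (1, 2), (1, 3), (2, 2), (2, 3), (3, 1)],
    3388073, [(33, False, 1, -1, 0, 4)],
    [(19, False, 1, 1, 0, 2), (34, True, -1, -1, 2, 1)]),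
   ([(0, 1), (0, 0), (1, 2), (2, 2)],
    [(1, -1), (1, 0), (1, 1), (2, 0), (2, 1), (3, 1)],
    1087508, [(23, True, 1, 1, 1, 2), (9, False, -1, -1, 0, 0)],
    [(35, True, -1, -1, 2, 2)]),
   ([(0, 1), (0, 0), (0, 2), (1, 3)],
    [(1, -1), (1, 0), (1, 1), (1, 2), (2, 2)],
    1142234, [(5, True, 1, 1, 0, 2), (10, True, -1, -1, 0, 0)],
    [(12, False, -1, -1, 1, 3)]),
   ([(0, 0), (0, 2)],
    [(-1, -1), (-1, 0), (-1, 2), (0, 1), (1, 1)],
    335050, [(9, True, 1, 1, 0, 2)],
    [(22, False, 1, 1, 0, -1), (9, True, 1, 1, 0, 2)]),
   ([(0, 0), (2, 2)],
    [(-1, 1), (0, 1), (1, 1), (1, 2), (1, 3)],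
    646966, [(7, False, 1, 1, 2, 2)],
    [(6, True, -1, -1, 1, 0), (18, False, 1, 1, 2, 2)]),
   ([(2, 3), (0, 1), (0, 2), (1, 0), (1, 4)],
    [(0, 3), (1, 1), (1, 2), (1, 3), (2, 1), (2, 2), (3, 3)],
    2010310, [(18, True, -1, 1, 1, 4), (19, False, 1, -1, 0, 2)],
    [(23, True, 1, 1, 1, 4), (19, False, 1, -1, 0, 2)]),
   ([(0, 0), (0, 3), (1, 1), (1, 2)],
    [(-1, 0), (-1, 2), (0, -1), (0, 1), (0, 2)],
    1005993, [(8, False, -1, 1, 1, 1)],
    [(30, False, -1, 1, 1, 0)]),
   ([(0, 1), (0, 0), (0, 2), (1, 3), (2, 2)],
    [(1, -1), (1, 0), (1, 1), (1, 2), (2, 0), (2, 1), (3, 1)],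
    1921101, [(25, True, -1, 1, 2, 2), (10, True, -1, -1, 0, 0)],
    [(25, False, -1, 1, 0, 0), (5, True, -1, 1, 2, 2)])]"

lemma valid_certificate: "list_all (valid_state certificate) certificate"
  by code_simp

section \<open>Soundness of the certificate\<close>

lemma covers_weight:
  assumes "0 \<le> z" "covers cs X R ps"
    and "\<And>q. q \<in> set ps \<Longrightarrow>
      weight z n (set (blocked (cs ! fst q))) (set (seeds (cs ! fst q))) \<le> bound (cs ! fst q) / scale"
  shows "weight z n (set X) (set R) \<le> bounds cs ps / scale ^ length ps"
  using assms(2,3)
proof (induction ps arbitrary: X)
  case Nil
  \<comment> \<open>With every seed blocked only the empty set remains; its weight 1 is the empty
    product.\<close>
  then have "set R \<subseteq> set X" by (auto simp: list_all_iff)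
  then show ?case by (simp add: weight_def animals_blocked bounds_def)
next
  case (Cons q ps)
  obtain i w a b s t where q: "q = (i, w, a, b, s, t)" by (cases q)
  define f where "f = place (w, a, b, s, t)"
  let ?R = "set (seeds (cs ! i))" and ?X = "set (blocked (cs ! i))"
  have ab: "a = 1 \<or> a = - 1" "b = 1 \<or> b = - 1" and sub: "f ` ?X \<subseteq> set X"
    and cov: "covers cs (map f (seeds (cs ! i)) @ X) R ps"
    using Cons.prems(1) by (auto simp: q f_def list_all_iff)
  have "weight z n (set X) (f ` ?R) \<le> weight z n (f ` ?X) (f ` ?R)"
    by (rule weight_mono) (use sub assms(1) in auto)
  also have "\<dots> \<le> weight z n ?X ?R"
    unfolding f_def by (rule weight_isometry) (use place_isometry[OF ab] assms(1) in auto)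
  also have "\<dots> \<le> bound (cs ! i) / scale"
    using Cons.prems(2)[of q] by (simp add: q)
  finally have first: "weight z n (set X) (f ` ?R) \<le> bound (cs ! i) / scale" .
  have rest: "weight z n (set X \<union> f ` ?R) (set R) \<le> bounds cs ps / scale ^ length ps"
    using Cons.IH[OF cov] Cons.prems(2) by (simp add: Un_commute)
  \<comment> \<open>Seeds of the piece that are missing from \<open>R\<close> are added first, so
    that the splitting rule separates the whole piece.\<close>
  have "weight z n (set X) (set R) \<le> weight z n (set X) (f ` ?R \<union> set R)"
    by (rule weight_mono) (use assms(1) in auto)
  also have "\<dots> \<le> weight z n (set X) (f ` ?R) * weight z n (set X \<union> f ` ?R) (set R)"
    by (rule weight_split) (use assms(1) in auto)
  also have "\<dots> \<le> bound (cs ! i) / scale * (bounds cs ps / scale ^ length ps)"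
    using first rest assms(1) by (intro mult_mono order_trans[OF weight_nonneg first] weight_nonneg)
  finally show ?case by (simp add: bounds_def q)
qed

text \<open>Lexicographic induction on \<open>n\<close> and the number of seeds: the pieces in
  \<open>P\<close> are used at a smaller cutoff, those in \<open>E\<close> at the same cutoff but
  with fewer seeds.\<close>

lemma valid_states_weight:
  assumes valid: "list_all (valid_state cs) cs" and "i < length cs"
  shows "weight (10000 / 45238) n (set (blocked (cs ! i))) (set (seeds (cs ! i)))
    \<le> bound (cs ! i) / scale"
  using assms(2)
proof (induction n arbitrary: i)
  case 0
  then have "valid_state cs (cs ! i)" using valid by (simp add: list_all_length)
  \<comment> \<open>At cutoff 0 only the empty set is counted, with weight 1; this is what
    \<open>scale \<le> p\<close> provides for.\<close>
  then have "scale \<le> bound (cs ! i)"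
    by (cases "(cs, cs ! i)" rule: valid_state.cases) (auto simp: bound_def)
  then show ?case by (simp add: weight_def animals_0 scale_def)
next
  case (Suc n)
  let ?z = "10000 / 45238 :: real"
  show ?case using Suc.prems
  proof (induction "length (seeds (cs ! i))" arbitrary: i rule: less_induct)
    case less
    obtain r R X p E P where C: "cs ! i = (r # R, X, p, E, P)"
      and ok: "valid_state cs (r # R, X, p, E, P)"
      using valid less.prems by (cases "(cs, cs ! i)" rule: valid_state.cases) (auto simp: list_all_length)
    have idx: "fst q < length cs" if "covers cs Y S ps" "q \<in> set ps" for Y S ps q
      using that by (induction cs Y S ps rule: covers.induct) auto
    have E: "weight ?z (Suc n) (set (r # X)) (set R) \<le> bounds cs E / scale ^ length E"
    proof (rule covers_weight)
      show cov: "covers cs (r # X) R E" using ok by simp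
      fix q assume q: "q \<in> set E"
      then have "length (seeds (cs ! fst q)) < length (seeds (cs ! i))"
        using ok by (auto simp: C seeds_def list_all_iff)
      then show "weight ?z (Suc n) (set (blocked (cs ! fst q))) (set (seeds (cs ! fst q)))
          \<le> bound (cs ! fst q) / scale"
        using less.hyps idx[OF cov q] by blast
    qed simp
    have P: "weight ?z n (set (r # X)) (set (nbrs r @ R)) \<le> bounds cs P / scale ^ length P"
    proof (rule covers_weight)
      show cov: "covers cs (r # X) (nbrs r @ R) P" using ok by simp
      fix q assume q: "q \<in> set P"
      then show "weight ?z n (set (blocked (cs ! fst q))) (set (seeds (cs ! fst q)))
          \<le> bound (cs ! fst q) / scale"
        using Suc.IH idx[OF cov q] by blast
    qed simp
    have "weight ?z (Suc n) (set X) (set (r # R)) \<le>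
        weight ?z (Suc n) (insert r (set X)) (set (r # R) - {r}) +
        ?z * weight ?z n (insert r (set X)) (set (r # R) - {r} \<union> {c. edge_adjacent r c})"
      by (rule weight_reveal) auto
    also have "\<dots> \<le> weight ?z (Suc n) (set (r # X)) (set R) +
        ?z * weight ?z n (set (r # X)) (set (nbrs r @ R))"
      by (intro add_mono mult_left_mono weight_mono) (auto simp: edge_adjacent_nbrs)
    also have "\<dots> \<le> bounds cs E / scale ^ length E + ?z * (bounds cs P / scale ^ length P)"
      using E P by simp
    also have "\<dots> \<le> p / scale"
    proof -
      \<comment> \<open>Dividing by \<open>45238 * scale ^ Suc (length E + length P)\<close> turns
        this into the claim.\<close>
      have "real_of_int (45238 * scale ^ Suc (length P) * bounds cs E +
          10000 * scale ^ Suc (length E) * bounds cs P)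
          \<le> real_of_int (45238 * scale ^ (length E + length P) * p)"
        using ok by (intro of_int_le_iff[THEN iffD2]) simp
      then show ?thesis
        by (simp add: scale_def field_simps power_add)
    qed
    finally show ?case by (simp add: C blocked_def seeds_def bound_def)
  qed
qed

corollary weight_origin_le:
  "weight (10000 / 45238) n {} {(0, 0)} \<le> 31"
proof -
  \<comment> \<open>State 0 is a single seed with nothing blocked; its bound 30.6649 is rounded up
    to 31.\<close>
  have "weight (10000 / 45238) n (set (blocked (certificate ! 0))) (set (seeds (certificate ! 0)))
      \<le> bound (certificate ! 0) / scale"
    by (rule valid_states_weight[OF valid_certificate]) (simp add: certificate_def)
  then show ?thesis by (simp add: certificate_def blocked_def seeds_def bound_def scale_def)
qed

section \<open>Counting polyominoes\<close>

lemma adj_in_edge_connected: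
  "edge_connected P \<longleftrightarrow> (\<forall>c\<in>P. \<forall>d\<in>P. (c, d) \<in> (adj_in P)\<^sup>*)"
  by (simp add: edge_connected_def adj_in_def)

definition shift :: "cell \<Rightarrow> cell \<Rightarrow> cell" where
  "shift t c = (fst c + fst t, snd c + snd t)"

lemma translate_shift: "translate t P = shift t ` P"
  by (simp add: translate_def shift_def)

lemma inj_shift: "inj (shift t)"
  by (auto simp: inj_def shift_def prod_eq_iff)

text \<open>Cells are ordered lexicographically, and translations preserve this order; hence
  \<open>Min\<close> can serve as a base point.\<close>

lemma mono_shift: "mono (shift t)"
  by (auto simp: mono_def shift_def less_eq_prod_def)

lemma translate_edge_connected:
  assumes "edge_connected P"
  shows "edge_connected (translate t P)"
proof -
  have "(shift t c, shift t d) \<in> (adj_in (shift t ` P))\<^sup>*" if "(c, d) \<in> (adj_in P)\<^sup>*" for c d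
    using that
  proof (induction rule: rtrancl_induct)
    case (step d e)
    then have "(shift t d, shift t e) \<in> adj_in (shift t ` P)"
      by (auto simp: adj_in_def edge_adjacent_def shift_def)
    with step.IH show ?case by (rule rtrancl_into_rtrancl)
  qed simp
  with assms show ?thesis by (auto simp: adj_in_edge_connected translate_shift)
qed

lemma translate_polyominoes: "P \<in> polyominoes n \<Longrightarrow> translate t P \<in> polyominoes n"
  using inj_on_subset[OF inj_shift] translate_edge_connected[of P t]
  by (auto simp: polyominoes_def polyomino_def translate_shift card_image)

lemma Min_translate:
  "finite P \<Longrightarrow> P \<noteq> {} \<Longrightarrow> Min (translate t P) = shift t (Min P)"
  by (simp add: translate_shift mono_Min_commute[OF mono_shift])

text \<open>A normal form: each translation class has exactly one member whose least cell is the
  origin.\<close>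

definition rooted :: "nat \<Rightarrow> cell set set" where
  "rooted n = {P \<in> polyominoes n. Min P = (0, 0)}"

lemma rootedD:
  assumes "P \<in> rooted n"
  shows "finite P" "P \<noteq> {}" "edge_connected P" "card P = n" "Min P = (0, 0)" "P \<in> polyominoes n"
  using assms by (auto simp: rooted_def polyominoes_def polyomino_def)

lemma num_polyominoes_rooted: "num_polyominoes n = card (rooted n)"
proof -
  let ?c = "\<lambda>P. translation_rel n `` {P}"
  have "inj_on ?c (rooted n)"
  proof (rule inj_onI)
    fix P Q assume P: "P \<in> rooted n" and Q: "Q \<in> rooted n" and "?c P = ?c Q"
    then have "(P, Q) \<in> translation_rel n"
      using equiv_translation_rel rootedD(6) by (metis eq_equiv_class)
    then obtain t where t: "Q = translate t P" by (auto simp: translation_rel_def)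
    then have "t = (0, 0)"
      using Min_translate[of P t] rootedD[OF P] rootedD(5)[OF Q] by (auto simp: shift_def prod_eq_iff)
    then show "P = Q" by (simp add: t translate_def)
  qed
  moreover have "?c ` rooted n = polyominoes n // translation_rel n"
  proof (intro equalityI subsetI)
    fix c assume "c \<in> polyominoes n // translation_rel n"
    then obtain P where P: "P \<in> polyominoes n" "c = ?c P" by (auto elim: quotientE)
    define t where "t = (- fst (Min P), - snd (Min P))"
    have "(P, translate t P) \<in> translation_rel n"
      using P translate_polyominoes unfolding translation_rel_def by blast
    then have "c = ?c (translate t P)"
      using P equiv_translation_rel by (metis equiv_class_eq)
    moreover have "translate t P \<in> rooted n"
      using P translate_polyominoes[OF P(1)] Min_translate[of P t]
      by (auto simp: rooted_def polyominoes_def polyomino_def shift_def t_def)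
    ultimately show "c \<in> ?c ` rooted n" by blast
  qed (auto intro: quotientI dest: rootedD(6))
  ultimately show ?thesis
    unfolding num_polyominoes_def by (metis card_image)
qed

lemma rooted_animals: "rooted n \<subseteq> animals n {} {(0, 0)}"
proof
  fix P assume P: "P \<in> rooted n"
  have "(0, 0) \<in> P" using Min_in rootedD[OF P] by metis
  then show "P \<in> animals n {} {(0, 0)}"
    using rootedD[OF P] by (auto simp: animals_def adj_in_edge_connected)
qed

lemma finite_rooted: "finite (rooted n)"
  by (rule finite_subset[OF rooted_animals]) (simp add: finite_animals)

lemma num_polyominoes_le: "real (num_polyominoes n) \<le> 31 * 4.5238 ^ n"
proof -
  let ?z = "10000 / 45238 :: real"
  \<comment> \<open>Rooted polyominoes all have \<open>n\<close> cells and are among the sets grown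
    from the origin; the remaining terms of the weight are nonnegative.\<close>
  have "real (num_polyominoes n) * ?z ^ n = (\<Sum>P\<in>rooted n. ?z ^ card P)"
    by (simp add: num_polyominoes_rooted rootedD(4))
  also have "\<dots> \<le> weight ?z n {} {(0, 0)}"
    unfolding weight_def by (rule sum_mono2) (use rooted_animals finite_animals in auto)
  also have "\<dots> \<le> 31" by (rule weight_origin_le)
  finally show ?thesis by (simp add: power_divide field_simps)
qed

section \<open>Concatenation and supermultiplicativity\<close>

lemma edge_connected_Un:
  assumes "edge_connected P" "edge_connected Q" "p \<in> P" "q \<in> Q" "edge_adjacent p q"
  shows "edge_connected (P \<union> Q)"
proof -
  let ?E = "(adj_in (P \<union> Q))\<^sup>*"
  have adj: "(p, q) \<in> ?E" "(q, p) \<in> ?E"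
    using assms(3-5) by (auto simp: adj_in_def edge_adjacent_def)
  have within: "(c, d) \<in> ?E" if "c \<in> P \<and> d \<in> P \<or> c \<in> Q \<and> d \<in> Q" for c d
    using that assms(1,2) adj_in_mono[of P "P \<union> Q"] adj_in_mono[of Q "P \<union> Q"]
    by (auto simp: adj_in_edge_connected)
  \<comment> \<open>The cell \<open>p\<close> acts as a hub; cells of \<open>Q\<close> reach it
    through \<open>q\<close>.\<close>
  have "(c, p) \<in> ?E \<and> (p, c) \<in> ?E" if "c \<in> P \<union> Q" for c
  proof (cases "c \<in> P")
    case True
    then show ?thesis using within assms(3) by simp
  next
    case False
    then have "(c, q) \<in> ?E" "(q, c) \<in> ?E" using within that assms(4) by simp_all
    then show ?thesis using adj by (blast intro: rtrancl_trans)
  qed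
  then show ?thesis
    unfolding adj_in_edge_connected by (blast intro: rtrancl_trans)
qed

text \<open>Initial segments of the same linearly ordered set are comparable, so equal size forces
  equality. This recovers the first polyomino from a concatenation.\<close>

lemma initial_segment_unique:
  fixes P :: "'a :: linorder set"
  assumes "P \<union> Q = P' \<union> Q'" "finite P" "finite P'" "card P = card P'"
    and "\<And>x y. x \<in> P \<Longrightarrow> y \<in> Q \<Longrightarrow> x < y" "\<And>x y. x \<in> P' \<Longrightarrow> y \<in> Q' \<Longrightarrow> x < y"
  shows "P = P'"
proof -
  have "P \<subseteq> P' \<or> P' \<subseteq> P"
  proof (rule ccontr)
    assume "\<not> ?thesis"
    then obtain x y where "x \<in> P" "x \<notin> P'" "y \<in> P'" "y \<notin> P" by blast
    then have "x \<in> Q'" "y \<in> Q" using assms(1) by auto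
    then show False using assms(5)[of x y] assms(6)[of y x] \<open>x \<in> P\<close> \<open>y \<in> P'\<close> by simp
  qed
  then show ?thesis using assms(2-4) by (metis card_subset_eq)
qed

lemma num_polyominoes_supermult:
  "num_polyominoes m * num_polyominoes n \<le> num_polyominoes (m + n)"
proof -
  \<comment> \<open>The immediate lexicographic successor of \<open>Max P\<close>, adjacent to it.
    Translating a rooted polyomino by \<open>t P\<close> moves its least cell there.\<close>
  define t where "t P = shift (0, 1) (Max P)" for P :: "cell set"
  let ?f = "\<lambda>(P, Q). P \<union> translate (t P) Q"
  \<comment> \<open>This ordering gives disjointness, keeps the least cell at the origin, and makes
    the concatenation decodable.\<close>
  have less: "x < y" if "P \<in> rooted m" "Q \<in> rooted n" "x \<in> P" "y \<in> translate (t P) Q" for P Q x y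
  proof -
    have "x \<le> Max P" using that rootedD by simp
    also have "\<dots> < t P" by (simp add: t_def shift_def less_prod_def prod_eq_iff)
    also have "\<dots> = Min (translate (t P) Q)"
      using rootedD[OF that(2)] by (simp add: Min_translate shift_def)
    also have "\<dots> \<le> y"
      using that rootedD(1)[OF that(2)] by (simp add: translate_shift)
    finally show ?thesis .
  qed
  have image: "?f ` (rooted m \<times> rooted n) \<subseteq> rooted (m + n)"
  proof clarify
    fix P Q assume P: "P \<in> rooted m" and Q: "Q \<in> rooted n"
    let ?Q = "translate (t P) Q"
    note p = rootedD[OF P] and q = rootedD[OF Q]
    have Q': "finite ?Q" "?Q \<noteq> {}" "edge_connected ?Q" "card ?Q = n"
      using translate_polyominoes[OF q(6), of "t P"] by (auto simp: polyominoes_def polyomino_def)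
    have "t P \<in> ?Q"
      using Min_in[OF Q'(1,2)] q by (simp add: Min_translate shift_def)
    moreover have "Max P \<in> P" using p by simp
    moreover have "edge_adjacent (Max P) (t P)" by (simp add: edge_adjacent_def t_def shift_def)
    ultimately have "edge_connected (P \<union> ?Q)"
      using p Q' edge_connected_Un by blast
    moreover have "P \<inter> ?Q = {}" using less[OF P Q] by fastforce
    then have "card (P \<union> ?Q) = m + n"
      using p Q' by (simp add: card_Un_disjoint)
    moreover have "Min (P \<union> ?Q) = (0, 0)"
    proof (rule Min_eqI)
      show "(0, 0) \<in> P \<union> ?Q" using Min_in[OF p(1,2)] p by simp
      fix y assume "y \<in> P \<union> ?Q"
      then show "(0, 0) \<le> y"
        using less[OF P Q, of "(0, 0)" y] Min_in[OF p(1,2)] Min_le[OF p(1), of y] p(5) by auto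
    qed (use p Q' in auto)
    ultimately show "P \<union> ?Q \<in> rooted (m + n)"
      using p Q' by (auto simp: rooted_def polyominoes_def polyomino_def)
  qed
  have "inj_on ?f (rooted m \<times> rooted n)"
  proof (rule inj_onI, clarify)
    fix P Q P' Q'
    assume *: "P \<in> rooted m" "Q \<in> rooted n" "P' \<in> rooted m" "Q' \<in> rooted n"
      and eq: "P \<union> translate (t P) Q = P' \<union> translate (t P') Q'"
    \<comment> \<open>Decoding: \<open>P\<close> is the initial segment with \<open>m\<close> cells;
      it determines \<open>t P\<close>, after which \<open>Q\<close> is found by cancelling the
      translation.\<close>
    have P: "P = P'"
    proof (rule initial_segment_unique[OF eq])
      show "finite P" "finite P'" "card P = card P'"
        using rootedD(1,4)[OF *(1)] rootedD(1,4)[OF *(3)] by simp_all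
    qed (fact less[OF *(1,2)] less[OF *(3,4)])+
    have "P \<inter> translate (t P) Q = {}" "P \<inter> translate (t P) Q' = {}"
      using less[OF *(1,2)] less[OF *(1,4)] by fastforce+
    then have "translate (t P) Q = translate (t P) Q'" using eq P by blast
    then have "Q = Q'" by (simp add: translate_shift inj_image_eq_iff[OF inj_shift])
    with P show "P = P' \<and> Q = Q'" by simp
  qed
  then have "card (rooted m \<times> rooted n) \<le> card (rooted (m + n))"
    using image finite_rooted by (rule card_inj_on_le)
  then show ?thesis by (simp add: num_polyominoes_rooted card_cartesian_product)
qed

text \<open>Appending one cell preserves positivity. Index 0 is excluded because polyominoes are
  nonempty, so the count there is 0 and has no useful logarithm.\<close>

lemma num_polyominoes_pos: "0 < n \<Longrightarrow> 0 < num_polyominoes n"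
proof (induction n rule: nat_induct_non_zero)
  have "{(0, 0)} \<in> rooted 1"
    by (auto simp: rooted_def polyominoes_def polyomino_def edge_connected_def)
  then show one: "0 < num_polyominoes 1"
    using finite_rooted by (auto simp: num_polyominoes_rooted card_gt_0_iff)
  fix n assume "0 < num_polyominoes n"
  with one have "0 < num_polyominoes n * num_polyominoes 1" by simp
  also have "\<dots> \<le> num_polyominoes (Suc n)" using num_polyominoes_supermult[of n 1] by simp
  finally show "0 < num_polyominoes (Suc n)" .
qed

section \<open>Fekete's lemma and existence of the limit\<close>

lemma superadditive_convergent:
  fixes a :: "nat \<Rightarrow> real" and C :: real
  assumes super: "\<And>m n. 0 < m \<Longrightarrow> 0 < n \<Longrightarrow> a m + a n \<le> a (m + n)"
    and nonneg: "\<And>n. 0 < n \<Longrightarrow> 0 \<le> a n"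
    and bounded: "\<And>n. 0 < n \<Longrightarrow> a n \<le> C * n"
  shows "convergent (\<lambda>n. a n / n)"
proof -
  let ?A = "(\<lambda>n. a n / n) ` {0<..}"
  \<comment> \<open>The limit is the supremum over positive indices, so only the lower estimate
    takes work.\<close>
  define L where "L = Sup ?A"
  have bdd: "bdd_above ?A"
    using bounded by (intro bdd_aboveI[of _ C]) (auto simp: field_simps)
  have "(1 :: nat) \<in> {0<..}" by simp
  then have ne: "?A \<noteq> {}" by blast
  have mult: "Suc q * a m \<le> a (Suc q * m)" if "0 < m" for q m
  proof (induction q)
    case (Suc q)
    have "a m + a (Suc q * m) \<le> a (m + Suc q * m)" using that by (intro super) auto
    with Suc show ?case by (simp add: algebra_simps)
  qed simp
  \<comment> \<open>Division with remainder: the whole multiples of \<open>m\<close> inside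
    \<open>n\<close> make up at least \<open>n - m\<close>, and the value at the remainder is
    nonnegative and can be discarded.\<close>
  have lower: "(1 - m / n) * (a m / m) \<le> a n / n" if "0 < m" "m \<le> n" for m n :: nat
  proof -
    have "n div m \<noteq> 0" using that by (simp add: div_eq_0_iff)
    then obtain q where q: "n div m = Suc q" using not0_implies_Suc by blast
    have n: "n = Suc q * m + n mod m"
      unfolding q[symmetric] by (rule div_mult_mod_eq[symmetric])
    have Suc_q: "Suc q * a m \<le> a n"
    \<comment> \<open>Superadditivity is assumed for positive arguments only, so a zero remainder is
      treated separately.\<close>
    proof (cases "n mod m = 0")
      case True
      then have "n = Suc q * m" using n by linarith
      then show ?thesis using mult[OF that(1), of q] by simp
    next
      case False
      have "a (Suc q * m) + a (n mod m) \<le> a (Suc q * m + n mod m)"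
        using that False by (intro super) auto
      then have "a (Suc q * m) + a (n mod m) \<le> a n" by (simp only: n[symmetric])
      then show ?thesis using mult[OF that(1), of q] nonneg[of "n mod m"] False by linarith
    qed
    have "n \<le> Suc q * m + m"
      using n mod_less_divisor[OF that(1), of n] by linarith
    then have "real n \<le> real (Suc q * m + m)" by (rule of_nat_mono)
    then have "real n - m \<le> Suc q * real m" by (simp add: algebra_simps)
    then have "(real n - m) * (a m / m) \<le> Suc q * real m * (a m / m)"
      using nonneg[OF that(1)] by (intro mult_right_mono) simp_all
    also have "\<dots> = Suc q * a m" using that(1) by simp
    finally have "(real n - m) * (a m / m) \<le> a n" using Suc_q by linarith
    then have "(real n - m) * (a m / m) / n \<le> a n / n" by (rule divide_right_mono) simp
    moreover have "1 - m / n = (real n - m) / n"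
      using that by (simp add: diff_divide_distrib)
    ultimately show ?thesis by (simp add: mult.commute)
  qed
  have "(\<lambda>n. a n / n) \<longlonglongrightarrow> L"
  proof (rule order_tendstoI)
    fix y assume "y < L"
    then have "\<exists>v\<in>?A. y < v"
      by (simp only: L_def less_cSup_iff[OF ne bdd])
    then obtain m :: nat where m: "0 < m" "y < a m / m" by blast
    \<comment> \<open>For this fixed \<open>m\<close> the lower estimate tends to
      \<open>a m / m\<close>, which already exceeds \<open>y\<close>.\<close>
    have "(\<lambda>n. (1 - m / real n) * (a m / m)) \<longlonglongrightarrow> (1 - 0) * (a m / m)"
      by (intro tendsto_intros lim_const_over_n)
    then have "\<forall>\<^sub>F n in sequentially. y < (1 - m / real n) * (a m / m)"
      using m by (intro order_tendstoD(1)) auto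
    with eventually_ge_at_top[of m] show "\<forall>\<^sub>F n in sequentially. y < a n / n"
    proof eventually_elim
      case (elim n)
      then show ?case using lower[OF m(1), of n] by linarith
    qed
  next
    fix y assume "L < y"
    have "a n / n < y" if "0 < n" for n
    proof -
      have "a n / n \<le> L"
        unfolding L_def by (rule cSup_upper[OF _ bdd]) (use that in blast)
      then show ?thesis using \<open>L < y\<close> by simp
    qed
    then show "\<forall>\<^sub>F n in sequentially. a n / n < y"
      by (rule eventually_mono[OF eventually_gt_at_top[of 0]])
  qed
  then show ?thesis by (rule convergentI)
qed

lemma root_num_polyominoes_convergent: "convergent (\<lambda>n. root n (num_polyominoes n))"
proof -
  let ?a = "\<lambda>n. ln (num_polyominoes n)"
  have pos: "0 < real (num_polyominoes n)" if "0 < n" for n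
    using num_polyominoes_pos[OF that] by simp
  have "convergent (\<lambda>n. ?a n / n)"
  proof (rule superadditive_convergent)
    fix m n :: nat assume "0 < m" "0 < n"
    then have "?a m + ?a n = ln (real (num_polyominoes m * num_polyominoes n))"
      using pos by (simp add: ln_mult)
    also have "\<dots> \<le> ?a (m + n)"
      using num_polyominoes_supermult[of m n] num_polyominoes_pos \<open>0 < m\<close> \<open>0 < n\<close>
      by (subst ln_le_cancel_iff) (auto simp flip: of_nat_mult)
    finally show "?a m + ?a n \<le> ?a (m + n)" .
  next
    fix n :: nat assume n: "0 < n"
    show "0 \<le> ?a n" using num_polyominoes_pos[OF n] by simp
    have "?a n \<le> ln (31 * 4.5238 ^ n)"
      using pos[OF n] num_polyominoes_le[of n] by (subst ln_le_cancel_iff) auto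
    also have "\<dots> = ln 31 + n * ln 4.5238" by (simp add: ln_mult ln_realpow)
    \<comment> \<open>As \<open>n\<close> is at least 1, the constant \<open>ln 31\<close> is
      absorbed into the linear term.\<close>
    also have "\<dots> \<le> (ln 31 + ln 4.5238) * n"
      using n by (simp add: algebra_simps)
    finally show "?a n \<le> (ln 31 + ln 4.5238) * n" .
  qed
  then obtain L where "(\<lambda>n. ?a n / n) \<longlonglongrightarrow> L" by (auto simp: convergent_def)
  then have "(\<lambda>n. exp (?a n / n)) \<longlonglongrightarrow> exp L" by (intro tendsto_exp)
  \<comment> \<open>The identity needs a positive count, hence only holds from index 1 on.\<close>
  moreover have "\<forall>\<^sub>F n in sequentially. exp (?a n / n) = root n (num_polyominoes n)"
    using eventually_gt_at_top[of 0]
  proof eventually_elim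
    case (elim n)
    then show ?case using pos[OF elim] num_polyominoes_pos[OF elim]
      by (simp add: root_powr_inverse powr_def field_simps)
  qed
  ultimately have "(\<lambda>n. root n (num_polyominoes n)) \<longlonglongrightarrow> exp L"
    by (rule Lim_transform_eventually)
  then show ?thesis by (rule convergentI)
qed

theorem theorem1:
  shows "klarner_constant \<le> 4.5238"
proof -
  \<comment> \<open>\<open>lim\<close> is a definite description; convergence is what makes it the
    actual limit.\<close>
  have "(\<lambda>n. root n (num_polyominoes n)) \<longlonglongrightarrow> klarner_constant"
    using root_num_polyominoes_convergent by (simp add: klarner_constant_def convergent_LIMSEQ_iff)
  \<comment> \<open>The constant factor 31 disappears because its \<open>n\<close>-th root tends to
    1.\<close>
  moreover have "(\<lambda>n. root n 31 * 4.5238) \<longlonglongrightarrow> 1 * 4.5238"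
    by (intro tendsto_intros LIMSEQ_root_const) simp
  moreover have "root n (num_polyominoes n) \<le> root n 31 * 4.5238" if "1 \<le> n" for n
  proof -
    have "root n (num_polyominoes n) \<le> root n (31 * 4.5238 ^ n)"
      using that num_polyominoes_le by simp
    also have "\<dots> = root n 31 * 4.5238"
      using that by (simp only: real_root_mult) (simp add: real_root_power_cancel)
    finally show ?thesis .
  qed
  ultimately have "klarner_constant \<le> 1 * 4.5238"
    by (meson LIMSEQ_le)
  then show ?thesis by simp
qed

end
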